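(* Let $f$, $A$, $b$, $F$, $\Omega$, $u$, $v=v(u)$, $z=z(u)$ be as in the context. Let sequences $\{v^k\}_{k\ge0}$, $\{\widetilde u^k=(\widetilde x^k,\widetilde\lambda^k)\}_{k\ge 0}$ (with $\widetilde v^k=v(\widetilde u^k)$) and $\{z^k\}_{k\ge0}$ satisfy, for every $k\ge 0$: (GPS) for all $u=(x,\lambda)$, $$f(x)-f(\widetilde{x}^k)+(u-\widetilde{u}^k)^TF(\widetilde{u}^k)\geq(v-\widetilde{v}^k)^TQ^k(v^k-\widetilde{v}^k)+\frac{\sigma}{2}\|z^k-z\|^2_R,$$ where $\sigma\ge0$, $R\succeq0$, $(Q^k)^T+Q^k\succeq 0$; (GCS) $v^{k+1}=v^k-M^k(v^k-\widetilde v^k)$; (CC1)-(CC2) there is a symmetric matrix $H^k$ with $Q^k=H^kM^k$, and $G^k:=(Q^k)^T+Q^k-(M^k)^TH^kM^k$. Let $x'\in\Omega$ and $\lambda\in\mathbb{R}^l$, put $u'=(x',\lambda)$, $v'=v(u')$, $z'=z(u')$, and suppose that (CC3) there are $r^k>0$, $H_0^k\succeq0$ and $\Theta^k\ge 0$ ($k\ge0$) such that for every $k\ge 0$ $$\begin{aligned} &r^k\left(\|v^{k+1}-v'\|^2_{H^k}+\sigma\|z^k-z'\|^2_R-\|v^k-v'\|^2_{H^k}+\|v^k-\widetilde{v}^k\|^2_{G^k}\right)\\ &\qquad\geq\|v^{k+1}-v'\|^2_{H_0^{k+1}}-\|v^k-v'\|^2_{H_0^k}+\Theta^{k+1}-\Theta^k.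 \end{aligned}$$ Define $\widetilde X^K=\big(\sum_{k=0}^K r^k\widetilde x^k\big)/\big(\sum_{k=0}^K r^k\big)$. Then $$f(\widetilde X^K)-f(x')-\lambda^T(A\widetilde X^K-b)\le O\left(1\Big/\sum_{k=0}^K r^k\right),$$ i.e. there is a constant $C$ independent of $K$ such that the left-hand side is at most $C/\sum_{k=0}^K r^k$ for all $K\ge 0$. In particular, if $r^k$ is of order $k$ (grows linearly in $k$), the left-hand side is at most $O(1/K^2)$.
   Context: Notation: $\|y\|_D^2:=y^TDy$ for a square symmetric matrix $D$, whether or not it is positive semidefinite. The underlying problem is $\min\{f(x): Ax=b\}$ with $f:\mathbb{R}^n\to\mathbb{R}$ closed proper convex, $A\in\mathbb{R}^{l\times n}$, $b\in\mathbb{R}^l$; $\Omega=\{x\in\mathbb{R}^n:Ax=b\}$ is the feasible region; $u=(x,\lambda)$ with $\lambda\in\mathbb{R}^l$ and $F(u)=(-A^T\lambda,\ Ax-b)$. The vector $v=v(u)$ is a linear function of $u$, in one of three settings: (P1) $v=u=(x,\lambda)$; (P2) $x=(x_1,x_2)$, $f(x)=f_1(x_1)+f_2(x_2)$, $Ax=A_1x_1+A_2x_2$, $v=(x_2,\lambda)$; (P3) $x=(x_1,\dots,x_m)$, $m\ge2$, $f(x)=\sum_i f_i(x_i)$, $Ax=\sum_iA_ix_i$, $v=(A_2x_2,\dots,A_mx_m,\lambda)$. The vector $z=z(u)$ is some auxiliary quantity determined by $u$ (for example $z=x$, $z=x_i$, or $z=\nabla f_i(x_i)$), and $z^k$ is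 a vector of the same dimension. The matrices $Q^k$, $M^k$, $H^k$, $H_0^k$ are square of the dimension of $v$; $Q^k$ need not be symmetric and $H^k$ need not be positive semidefinite. The constant $C$ may depend on $x'$, $\lambda$ and the initial data, but not on $K$. *)

theory Defs
  imports "HOL-Analysis.Analysis" "HOL-Library.Landau_Symbols"
begin

definition psd :: "real^'d^'d \<Rightarrow> bool" where
  "psd D \<longleftrightarrow> transpose D = D \<and> (\<forall>y. 0 \<le> y \<bullet> (D *v y))"

text \<open>The square of the weighted ``norm''; the matrix need not be positive semidefinite,
  so the value may be negative.\<close>

definition wnorm2 :: "real^'d^'d \<Rightarrow> real^'d \<Rightarrow> real" where
  "wnorm2 D y = y \<bullet> (D *v y)"

definition feasible :: "real^'n^'l \<Rightarrow> real^'l \<Rightarrow> (real^'n) set" where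
  "feasible A b = {x. A *v x = b}"

definition Fop :: "real^'n^'l \<Rightarrow> real^'l \<Rightarrow> (real^'n) \<times> (real^'l) \<Rightarrow> (real^'n) \<times> (real^'l)" where
  "Fop A b u = (- (transpose A *v snd u), A *v fst u - b)"

text \<open>Block structure \<open>x = (x\<^sub>1, \<dots>, x\<^sub>m)\<close>: a map \<open>blk\<close> assigns to every coordinate of
  \<open>x\<close> the number of its block, every block being nonempty. The block \<open>x\<^sub>i\<close> is represented by the
  vector obtained from \<open>x\<close> by zeroing all coordinates outside block \<open>i\<close>; with this
  representation \<open>A\<^sub>i x\<^sub>i\<close> is \<open>A *v vec_block blk i x\<close>, where \<open>A\<^sub>i\<close> consists of the columns of
  \<open>A\<close> in block \<open>i\<close>, and \<open>A x = (\<Sum>i. A\<^sub>i x\<^sub>i)\<close> holds automatically.\<close>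

definition block_partition :: "('n::finite \<Rightarrow> nat) \<Rightarrow> nat \<Rightarrow> bool" where
  "block_partition blk m \<longleftrightarrow> blk ` UNIV = {1..m}"

definition vec_block :: "('n \<Rightarrow> nat) \<Rightarrow> nat \<Rightarrow> real^'n \<Rightarrow> real^'n" where
  "vec_block blk i x = (\<chi> j. if blk j = i then x $ j else 0)"

definition block_separable :: "('n \<Rightarrow> nat) \<Rightarrow> nat \<Rightarrow> (real^'n \<Rightarrow> real) \<Rightarrow> bool" where
  "block_separable blk m f \<longleftrightarrow>
     (\<exists>g :: nat \<Rightarrow> real^'n \<Rightarrow> real. \<forall>x. f x = (\<Sum>i=1..m. g i (vec_block blk i x)))"

text \<open>The three settings for \<open>v = v(u)\<close>. The vector \<open>v(u)\<close> is a concatenation of vectors; as the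
  coordinates of \<open>real^'d\<close> are indexed by a finite type without preferred order, the
  concatenation is expressed by a bijection \<open>e\<close> from \<open>'d\<close> to the set of all coordinates of the
  pieces, which in particular fixes the dimension of \<open>v\<close>.\<close>

definition setting_P1 ::
  "((real^'n) \<times> (real^'l) \<Rightarrow> real^'d) \<Rightarrow> bool" where
  "setting_P1 v \<longleftrightarrow>
     (\<exists>e :: 'd \<Rightarrow> 'n + 'l. bij_betw e UNIV UNIV \<and>
        (\<forall>x lam j. v (x, lam) $ j = (case e j of Inl i \<Rightarrow> x $ i | Inr q \<Rightarrow> lam $ q)))"

definition setting_P2 ::
  "(real^'n \<Rightarrow> real) \<Rightarrow> ((real^'n) \<times> (real^'l) \<Rightarrow> real^'d) \<Rightarrow> bool" where
  "setting_P2 f v \<longleftrightarrow>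
     (\<exists>blk. block_partition blk 2 \<and> block_separable blk 2 f \<and>
       (\<exists>e :: 'd \<Rightarrow> 'n + 'l. bij_betw e UNIV ({i. blk i = 2} <+> UNIV) \<and>
          (\<forall>x lam j. v (x, lam) $ j = (case e j of Inl i \<Rightarrow> x $ i | Inr q \<Rightarrow> lam $ q))))"

definition setting_P3 ::
  "(real^'n \<Rightarrow> real) \<Rightarrow> real^'n^'l \<Rightarrow> ((real^'n) \<times> (real^'l) \<Rightarrow> real^'d) \<Rightarrow> bool" where
  "setting_P3 f A v \<longleftrightarrow>
     (\<exists>blk m. m \<ge> 2 \<and> block_partition blk m \<and> block_separable blk m f \<and>
       (\<exists>e :: 'd \<Rightarrow> (nat \<times> 'l) + 'l. bij_betw e UNIV (({2..m} \<times> UNIV) <+> UNIV) \<and>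
          (\<forall>x lam j. v (x, lam) $ j =
             (case e j of Inl (i, p) \<Rightarrow> (A *v vec_block blk i x) $ p | Inr q \<Rightarrow> lam $ q))))"

text \<open>In the following, \<open>v\<close> and \<open>z\<close> are the maps \<open>u \<mapsto> v(u)\<close> and \<open>u \<mapsto> z(u)\<close>; \<open>vs\<close> and \<open>zs\<close> are
  the sequences \<open>v\<^sup>k\<close> and \<open>z\<^sup>k\<close>; and \<open>ut\<close> is the sequence of the predicted points
  (u-tilde), so that the k-th v-tilde is \<open>v (ut k)\<close>.\<close>

definition GPS ::
  "(real^'n \<Rightarrow> real) \<Rightarrow> real^'n^'l \<Rightarrow> real^'l
   \<Rightarrow> ((real^'n) \<times> (real^'l) \<Rightarrow> real^'d) \<Rightarrow> ((real^'n) \<times> (real^'l) \<Rightarrow> real^'z)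
   \<Rightarrow> real \<Rightarrow> real^'z^'z
   \<Rightarrow> (nat \<Rightarrow> real^'d) \<Rightarrow> (nat \<Rightarrow> (real^'n) \<times> (real^'l)) \<Rightarrow> (nat \<Rightarrow> real^'z)
   \<Rightarrow> (nat \<Rightarrow> real^'d^'d) \<Rightarrow> bool" where
  "GPS f A b v z \<sigma> R vs ut zs Q \<longleftrightarrow>
     (\<forall>k. psd (transpose (Q k) + Q k) \<and>
       (\<forall>u. f (fst u) - f (fst (ut k)) + (u - ut k) \<bullet> Fop A b (ut k)
              \<ge> (v u - v (ut k)) \<bullet> (Q k *v (vs k - v (ut k)))
                + \<sigma> / 2 * wnorm2 R (zs k - z u)))"

definition GCS ::
  "((real^'n) \<times> (real^'l) \<Rightarrow> real^'d)
   \<Rightarrow> (nat \<Rightarrow> real^'d) \<Rightarrow> (nat \<Rightarrow> (real^'n) \<times> (real^'l)) \<Rightarrow> (nat \<Rightarrow> real^'d^'d) \<Rightarrow> bool" where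
  "GCS v vs ut M \<longleftrightarrow> (\<forall>k. vs (Suc k) = vs k - M k *v (vs k - v (ut k)))"

definition CC1 ::
  "(nat \<Rightarrow> real^'d^'d) \<Rightarrow> (nat \<Rightarrow> real^'d^'d) \<Rightarrow> (nat \<Rightarrow> real^'d^'d) \<Rightarrow> bool" where
  "CC1 Q M H \<longleftrightarrow> (\<forall>k. transpose (H k) = H k \<and> Q k = H k ** M k)"

definition Gmat :: "real^'d^'d \<Rightarrow> real^'d^'d \<Rightarrow> real^'d^'d \<Rightarrow> real^'d^'d" where
  "Gmat Q M H = transpose Q + Q - transpose M ** H ** M"

definition CC3 ::
  "((real^'n) \<times> (real^'l) \<Rightarrow> real^'d) \<Rightarrow> ((real^'n) \<times> (real^'l) \<Rightarrow> real^'z)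
   \<Rightarrow> real \<Rightarrow> real^'z^'z \<Rightarrow> (real^'n) \<times> (real^'l)
   \<Rightarrow> (nat \<Rightarrow> real^'d) \<Rightarrow> (nat \<Rightarrow> (real^'n) \<times> (real^'l)) \<Rightarrow> (nat \<Rightarrow> real^'z)
   \<Rightarrow> (nat \<Rightarrow> real^'d^'d) \<Rightarrow> (nat \<Rightarrow> real^'d^'d) \<Rightarrow> (nat \<Rightarrow> real^'d^'d)
   \<Rightarrow> (nat \<Rightarrow> real) \<Rightarrow> (nat \<Rightarrow> real^'d^'d) \<Rightarrow> (nat \<Rightarrow> real) \<Rightarrow> bool" where
  "CC3 v z \<sigma> R u' vs ut zs Q M H r H0 \<theta> \<longleftrightarrow>
     (\<forall>k. r k > 0 \<and> psd (H0 k) \<and> \<theta> k \<ge> 0 \<and>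
       r k * (wnorm2 (H k) (vs (Suc k) - v u') + \<sigma> * wnorm2 R (zs k - z u')
              - wnorm2 (H k) (vs k - v u')
              + wnorm2 (Gmat (Q k) (M k) (H k)) (vs k - v (ut k)))
         \<ge> wnorm2 (H0 (Suc k)) (vs (Suc k) - v u') - wnorm2 (H0 k) (vs k - v u')
           + \<theta> (Suc k) - \<theta> k)"

definition wavg :: "(nat \<Rightarrow> real) \<Rightarrow> (nat \<Rightarrow> 'a::real_vector) \<Rightarrow> nat \<Rightarrow> 'a" where
  "wavg r xs K = (1 / (\<Sum>k\<le>K. r k)) *\<^sub>R (\<Sum>k\<le>K. r k *\<^sub>R xs k)"

end

theory Submission
  imports Defs
begin

text \<open>
  For a fixed multiplier \<open>\<lambda>\<close> and a fixed feasible \<open>x'\<close> the quantity to be bounded is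
  \<open>L(X) - f(x')\<close>, where \<open>L(x) = f(x) - \<lambda>\<^sup>T(A x - b)\<close> is the Lagrangian, a convex function of \<open>x\<close>.
  The prediction inequality at \<open>u' = (x', \<lambda>)\<close> bounds \<open>L\<close> at the single predicted point: the
  skew part of the affine monotone operator \<open>F\<close> cancels, and only \<open>\<lambda>\<^sup>T(A x - b)\<close> survives
  (\<open>Fop_gap_at_feasible\<close>). With \<open>t\<close> for the predicted value of \<open>v\<close>, the bound is
  \<open>- (v' - t)\<^sup>T Q (v - t)\<close> minus the \<open>\<sigma>\<close>-term. By polarization, twice this product is a
  difference of squared \<open>H\<close>-distances to \<open>v'\<close> plus the \<open>G\<close>-norm of \<open>v - t\<close>
  (\<open>correction_step_identity\<close>); this is where the form of \<open>G\<close> comes from.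

  Hence twice the gap \<open>L - f(x')\<close> at the \<open>k\<close>-th predicted point is at most minus the bracket
  that CC3 multiplies by \<open>r\<^sup>k\<close>. The squared \<open>H\<^sup>k\<close>-distances in it would not telescope, since
  \<open>H\<^sup>k\<close> varies with \<open>k\<close> and may be indefinite. CC3 exchanges them, after weighting by \<open>r\<^sup>k\<close>,
  for the decrease of the potential \<open>\<parallel>v\<^sup>k - v'\<parallel>\<^sup>2 + \<Theta>\<^sup>k\<close>, the norm being that of \<open>H\<^sub>0\<^sup>k\<close>
  (\<open>weighted_gap_le_decrease\<close>). The potential is nonnegative, so the sum of the gaps with
  weights \<open>r\<^sup>k\<close> is at most half its initial value, and Jensen's inequality for \<open>L\<close> passes to
  the weighted average. If \<open>r\<^sup>k\<close> grows linearly, the sum of the weights grows quadratically,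
  which gives the second rate.
\<close>

lemma wnorm2_nonneg: "psd D \<Longrightarrow> 0 \<le> wnorm2 D y"
  by (simp add: psd_def wnorm2_def)

text \<open>The terms with the multiplier component of \<open>u\<close> cancel because \<open>A x' = b\<close> and the linear
  part of the operator is skew-symmetric.\<close>

lemma Fop_gap_at_feasible:
  assumes "x' \<in> feasible A b"
  shows "((x', lam) - u) \<bullet> Fop A b u = lam \<bullet> (A *v fst u - b)"
proof -
  have "(x' - fst u) \<bullet> (transpose A *v snd u) = (A *v (x' - fst u)) \<bullet> snd u"
    by (simp add: dot_lmul_matrix inner_commute)
  also have "\<dots> = - ((A *v fst u - b) \<bullet> snd u)"
    using assms
    by (simp add: feasible_def matrix_vector_mult_diff_distrib inner_diff_left)
  finally show ?thesis
    by (simp add: Fop_def inner_prod_def inner_diff_left inner_diff_right inner_commute)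
qed

text \<open>Write \<open>d = M (v - t)\<close> for the correction step. Then \<open>Q (v - t) = H d\<close>, the \<open>G\<close>-term is
  \<open>2 (v - t)\<^sup>T H d - d\<^sup>T H d\<close>, and expanding \<open>\<parallel>v - d - w\<parallel>\<^sup>2\<close> in the symmetric form \<open>H\<close> produces
  the opposite square \<open>d\<^sup>T H d\<close>; only the cross terms remain.\<close>

lemma correction_step_identity:
  fixes H M Q :: "real^'d^'d" and v t w :: "real^'d"
  assumes sym: "transpose H = H" and Q: "Q = H ** M"
  shows "2 * ((w - t) \<bullet> (Q *v (v - t))) =
    wnorm2 H (v - M *v (v - t) - w) - wnorm2 H (v - w) + wnorm2 (Gmat Q M H) (v - t)"
proof -
  define y where "y = v - t"
  define d where "d = M *v y"
  have Hsym: "x \<bullet> (H *v y') = y' \<bullet> (H *v x)" for x y'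
    by (metis dot_lmul_matrix inner_commute sym transpose_matrix_vector)
  have Qy: "Q *v y = H *v d"
    by (simp add: Q d_def matrix_vector_mul_assoc)
  have Qt: "y \<bullet> (transpose Q *v y) = y \<bullet> (Q *v y)"
    by (metis dot_lmul_matrix inner_commute transpose_matrix_vector)
  have "y \<bullet> (transpose M ** H ** M *v y) = y \<bullet> (transpose M *v (H *v d))"
    by (simp add: d_def matrix_vector_mul_assoc matrix_mul_assoc)
  also have "\<dots> = d \<bullet> (H *v d)"
    unfolding d_def by (metis dot_lmul_matrix inner_commute transpose_matrix_vector)
  finally have G: "wnorm2 (Gmat Q M H) y = 2 * (y \<bullet> (H *v d)) - d \<bullet> (H *v d)"
    using Qt Qy
    by (simp add: wnorm2_def Gmat_def matrix_vector_mult_diff_rdistrib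
        matrix_vector_mult_add_rdistrib inner_diff_right inner_add_right)
  have "wnorm2 H ((v - w) - d) - wnorm2 H (v - w) = d \<bullet> (H *v d) - 2 * ((v - w) \<bullet> (H *v d))"
    using Hsym[of d "v - w"]
    by (simp add: wnorm2_def matrix_vector_mult_diff_distrib inner_diff_left inner_diff_right)
  moreover have "(w - t) \<bullet> (H *v d) = y \<bullet> (H *v d) - (v - w) \<bullet> (H *v d)"
    by (simp add: y_def inner_diff_left)
  moreover have rearrange: "v - d - w = (v - w) - d"
    by simp
  ultimately show ?thesis
    unfolding y_def[symmetric] d_def[symmetric] rearrange
    using G Qy by simp
qed

text \<open>The prediction inequality at \<open>(x', \<lambda>)\<close>, rewritten by the two identities above, says that
  the bracket \<open>?E\<close> of CC3 is at most minus twice the Lagrangian gap; CC3 bounds \<open>r k * ?E\<close> from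
  below by the increase of the potential.\<close>

lemma weighted_gap_le_decrease:
  assumes feas: "x' \<in> feasible A b"
    and gps: "GPS f A b v z \<sigma> R vs ut zs Q"
    and gcs: "GCS v vs ut M"
    and cc1: "CC1 Q M H"
    and cc3: "CC3 v z \<sigma> R (x', lam) vs ut zs Q M H r H0 \<theta>"
  shows "2 * (r k * (f (fst (ut k)) - f x' - lam \<bullet> (A *v fst (ut k) - b)))
    \<le> (wnorm2 (H0 k) (vs k - v (x', lam)) + \<theta> k)
      - (wnorm2 (H0 (Suc k)) (vs (Suc k) - v (x', lam)) + \<theta> (Suc k))"
proof -
  let ?w = "v (x', lam)"
  let ?gap = "f (fst (ut k)) - f x' - lam \<bullet> (A *v fst (ut k) - b)"
  let ?E = "wnorm2 (H k) (vs (Suc k) - ?w) + \<sigma> * wnorm2 R (zs k - z (x', lam))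
    - wnorm2 (H k) (vs k - ?w) + wnorm2 (Gmat (Q k) (M k) (H k)) (vs k - v (ut k))"
  have "f x' - f (fst (ut k)) + ((x', lam) - ut k) \<bullet> Fop A b (ut k)
      \<ge> (?w - v (ut k)) \<bullet> (Q k *v (vs k - v (ut k))) + \<sigma> / 2 * wnorm2 R (zs k - z (x', lam))"
    using gps unfolding GPS_def by (metis fst_conv)
  moreover have "2 * ((?w - v (ut k)) \<bullet> (Q k *v (vs k - v (ut k)))) =
      wnorm2 (H k) (vs (Suc k) - ?w) - wnorm2 (H k) (vs k - ?w)
      + wnorm2 (Gmat (Q k) (M k) (H k)) (vs k - v (ut k))"
    using cc1 gcs correction_step_identity[of "H k" "Q k" "M k" ?w "v (ut k)" "vs k"]
    by (simp add: CC1_def GCS_def)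
  ultimately have "2 * ?gap \<le> - ?E"
    using Fop_gap_at_feasible[OF feas, of lam "ut k"] by simp
  moreover have "r k > 0"
    using cc3 by (simp add: CC3_def)
  ultimately have "r k * (2 * ?gap) \<le> r k * (- ?E)"
    by (intro mult_left_mono) auto
  moreover have "r k * ?E \<ge> wnorm2 (H0 (Suc k)) (vs (Suc k) - ?w) - wnorm2 (H0 k) (vs k - ?w)
      + \<theta> (Suc k) - \<theta> k"
    using cc3 unfolding CC3_def by blast
  ultimately show ?thesis
    by (simp add: algebra_simps)
qed

lemma convex_on_wavg_le:
  fixes f :: "'a::real_vector \<Rightarrow> real"
  assumes "convex_on UNIV f" and pos: "\<And>k. r k > 0"
  shows "f (wavg r xs K) \<le> (\<Sum>k\<le>K. r k * f (xs k)) / (\<Sum>k\<le>K. r k)"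
proof -
  define S where "S = (\<Sum>k\<le>K. r k)"
  have S: "S > 0"
    unfolding S_def using pos by (intro sum_pos) auto
  have "f (\<Sum>k\<le>K. (r k / S) *\<^sub>R xs k) \<le> (\<Sum>k\<le>K. (r k / S) * f (xs k))"
    using assms S
    by (intro convex_on_sum[of _ UNIV])
       (auto simp: sum_divide_distrib[symmetric] S_def[symmetric] less_imp_le)
  moreover have "wavg r xs K = (\<Sum>k\<le>K. (r k / S) *\<^sub>R xs k)"
    by (simp add: wavg_def S_def[symmetric] scaleR_sum_right)
  ultimately show ?thesis
    by (simp add: S_def[symmetric] sum_divide_distrib)
qed

lemma convex_on_lagrangian:
  fixes A :: "real^'n^'l"
  assumes "convex_on UNIV f"
  shows "convex_on UNIV (\<lambda>x. f x - lam \<bullet> (A *v x - b))"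
proof (rule convex_onI)
  fix t :: real and x y
  assume t: "0 < t" "t < 1"
  have "f ((1 - t) *\<^sub>R x + t *\<^sub>R y) \<le> (1 - t) * f x + t * f y"
    using convex_onD[OF assms] t by simp
  moreover have "A *v ((1 - t) *\<^sub>R x + t *\<^sub>R y) - b
      = (1 - t) *\<^sub>R (A *v x - b) + t *\<^sub>R (A *v y - b)"
    by (simp add: algebra_simps)
  ultimately show "f ((1 - t) *\<^sub>R x + t *\<^sub>R y) - lam \<bullet> (A *v ((1 - t) *\<^sub>R x + t *\<^sub>R y) - b)
      \<le> (1 - t) * (f x - lam \<bullet> (A *v x - b)) + t * (f y - lam \<bullet> (A *v y - b))"
    by (simp add: inner_add_right right_diff_distrib)
qed simp

text \<open>Asymptotic linear growth bounds only the tail from below; the finitely many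
  remaining weights are positive, so shrinking the constant covers them as well.\<close>

lemma sum_ge_square_if_bigomega:
  fixes r :: "nat \<Rightarrow> real"
  assumes pos: "\<And>k. r k > 0" and om: "r \<in> \<Omega>(\<lambda>k. real k)"
  obtains c where "c > 0" "\<And>K. c * (real K)\<^sup>2 \<le> (\<Sum>k\<le>K. r k)"
proof -
  obtain c0 N where c0: "c0 > 0" and N: "\<And>k. k \<ge> N \<Longrightarrow> r k \<ge> c0 * real k"
    using om pos
    by (elim landau_omega.bigE) (auto simp: eventually_at_top_linorder abs_of_pos)
  \<comment> \<open>The denominator is \<open>k + 1\<close> because \<open>r 0 / 0 = 0\<close> would make the minimum vanish.\<close>
  define c where "c = Min (insert c0 ((\<lambda>k. r k / real (Suc k)) ` {..<N}))"
  have c: "c > 0"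
    using c0 pos by (auto simp: c_def)
  have r_ge: "c * real k \<le> r k" for k
  proof (cases "k < N")
    case True
    then have "c \<le> r k / real (Suc k)"
      unfolding c_def by (intro Min_le) auto
    then have "c * real (Suc k) \<le> r k"
      by (simp add: pos_le_divide_eq)
    then show ?thesis
      using c by (simp add: algebra_simps)
  next
    case False
    have "c \<le> c0"
      unfolding c_def by (intro Min_le) auto
    then have "c * real k \<le> c0 * real k"
      by (intro mult_right_mono) auto
    then show ?thesis
      using N[of k] False by simp
  qed
  have "c / 2 * (real K)\<^sup>2 \<le> (\<Sum>k\<le>K. r k)" for K
  proof -
    have "c / 2 * (real K)\<^sup>2 \<le> (\<Sum>k\<le>K. c * real k)"
      using c by (induction K) (auto simp: power2_eq_square algebra_simps)
    also have "\<dots> \<le> (\<Sum>k\<le>K. r k)"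
      by (intro sum_mono r_ge)
    finally show ?thesis .
  qed
  then show ?thesis
    using c that[of "c / 2"] by simp
qed

theorem theorem2p3:
  fixes f :: "real^'n \<Rightarrow> real"
    and A :: "real^'n^'l"
    and b :: "real^'l"
    and v :: "(real^'n) \<times> (real^'l) \<Rightarrow> real^'d"
    and z :: "(real^'n) \<times> (real^'l) \<Rightarrow> real^'z"
    and \<sigma> :: real
    and R :: "real^'z^'z"
    and x' :: "real^'n"
    and lam :: "real^'l"
    and v0 :: "real^'d"
    and H00 :: "real^'d^'d"
    and \<theta>0 :: real
  assumes convex: "convex_on UNIV f"
    and closed: "closed (epigraph UNIV f)"
    and setting: "setting_P1 v \<or> setting_P2 f v \<or> setting_P3 f A v"
    and sigma: "\<sigma> \<ge> 0"
    and R: "psd R"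
    and feas: "x' \<in> feasible A b"
  shows "\<exists>C::real.
    \<forall>(vs :: nat \<Rightarrow> real^'d) (ut :: nat \<Rightarrow> (real^'n) \<times> (real^'l)) (zs :: nat \<Rightarrow> real^'z)
      (Q :: nat \<Rightarrow> real^'d^'d) (M :: nat \<Rightarrow> real^'d^'d) (H :: nat \<Rightarrow> real^'d^'d)
      (r :: nat \<Rightarrow> real) (H0 :: nat \<Rightarrow> real^'d^'d) (\<theta> :: nat \<Rightarrow> real).
      vs 0 = v0 \<and> H0 0 = H00 \<and> \<theta> 0 = \<theta>0 \<and>
      GPS f A b v z \<sigma> R vs ut zs Q \<and> GCS v vs ut M \<and> CC1 Q M H \<and>
      CC3 v z \<sigma> R (x', lam) vs ut zs Q M H r H0 \<theta>
      \<longrightarrow>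
      (let X = wavg r (\<lambda>k. fst (ut k)) in
        (\<forall>K. f (X K) - f x' - lam \<bullet> (A *v X K - b) \<le> C / (\<Sum>k\<le>K. r k)) \<and>
        (r \<in> \<Theta>(\<lambda>k. real k) \<longrightarrow>
          (\<exists>C'. \<forall>K\<ge>1. f (X K) - f x' - lam \<bullet> (A *v X K - b) \<le> C' / (real K)\<^sup>2)))"
proof -
  \<comment> \<open>Half the initial value of the potential.\<close>
  define C where "C = (wnorm2 H00 (v0 - v (x', lam)) + \<theta>0) / 2"
  show ?thesis
    unfolding Let_def
  proof (intro exI[of _ C] allI impI, elim conjE, goal_cases)
    case (1 vs ut zs Q M H r H0 \<theta>)
    note cc3 = \<open>CC3 v z \<sigma> R (x', lam) vs ut zs Q M H r H0 \<theta>\<close>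
    define L where "L x = f x - lam \<bullet> (A *v x - b)" for x
    define P where "P k = wnorm2 (H0 k) (vs k - v (x', lam)) + \<theta> k" for k
    define X where "X = wavg r (\<lambda>k. fst (ut k))"
    have r: "r k > 0" and P: "P k \<ge> 0" for k
      using cc3 by (auto simp: CC3_def P_def wnorm2_nonneg)
    have P0: "P 0 = 2 * C"
      using 1 by (simp add: P_def C_def)
    have S: "(\<Sum>k\<le>K. r k) > 0" for K
      using r by (intro sum_pos) auto
    have bound: "L (X K) - f x' \<le> C / (\<Sum>k\<le>K. r k)" for K
    proof -
      have "2 * (r k * (L (fst (ut k)) - f x')) \<le> P k - P (Suc k)" for k
        using weighted_gap_le_decrease[OF feas 1(4-6) cc3, of k]
        by (simp add: L_def P_def algebra_simps)
      then have "(\<Sum>k\<le>K. 2 * (r k * (L (fst (ut k)) - f x'))) \<le> (\<Sum>k\<le>K. P k - P (Suc k))"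
        by (rule sum_mono)
      also have "\<dots> = P 0 - P (Suc K)"
        by (rule sum_telescope)
      also have "\<dots> \<le> 2 * C"
        using P P0 by simp
      finally have gaps: "(\<Sum>k\<le>K. r k * L (fst (ut k))) - f x' * (\<Sum>k\<le>K. r k) \<le> C"
        by (simp add: sum_distrib_left[symmetric] right_diff_distrib sum_subtractf
            sum_distrib_right[symmetric] mult.commute)
      have "L (X K) \<le> (\<Sum>k\<le>K. r k * L (fst (ut k))) / (\<Sum>k\<le>K. r k)"
        unfolding X_def L_def by (intro convex_on_wavg_le convex_on_lagrangian convex r)
      then have "L (X K) - f x'
          \<le> ((\<Sum>k\<le>K. r k * L (fst (ut k))) - f x' * (\<Sum>k\<le>K. r k)) / (\<Sum>k\<le>K. r k)"
        using S[of K] by (simp add: diff_divide_distrib)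
      also have "\<dots> \<le> C / (\<Sum>k\<le>K. r k)"
        using gaps S[of K] by (simp add: divide_right_mono)
      finally show ?thesis .
    qed
    have "\<exists>C'. \<forall>K\<ge>1. L (X K) - f x' \<le> C' / (real K)\<^sup>2" if "r \<in> \<Theta>(\<lambda>k. real k)"
    proof -
      from that have "r \<in> \<Omega>(\<lambda>k. real k)"
        by (rule bigthetaD2)
      then obtain c where c: "c > 0" "\<And>K. c * (real K)\<^sup>2 \<le> (\<Sum>k\<le>K. r k)"
        using sum_ge_square_if_bigomega[of r] r by blast
      have "L (X K) - f x' \<le> (C / c) / (real K)\<^sup>2" if "K \<ge> 1" for K
      proof -
        have "C / (\<Sum>k\<le>K. r k) \<le> C / (c * (real K)\<^sup>2)"
          using c S[of K] P[of 0] P0 that by (intro divide_left_mono) auto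
        then show ?thesis
          using bound[of K] by simp
      qed
      then show ?thesis by blast
    qed
    with bound show ?case
      by (auto simp: L_def X_def algebra_simps)
  qed
qed

end
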